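(* Let $X$ be a Polish space and $Y=\{u_i\}_{i=1}^m$ (with $u_1,\dots,u_m$ distinct). Assume $c:X\times Y\to(-\infty,\infty]$ is a measurable cost function, $\mu\in\mathcal P(X)$ is $c$-regular and $\nu=\sum_{i=1}^m\alpha_i\mathbb 1_{u_i}\in\mathcal P(Y)$. Assume furthermore that the intersection $$\{x\in X:\ c(x,u_i)<\infty\}\cap\{x\in X:\ c(x,u_j)<\infty\}$$ contains a (non-empty) open set for each pair $u_i,u_j$. If $\mu$ and $\nu$ are strongly $c$-compatible, then there exists an optimal transport plan $\pi\in\Pi(\mu,\nu)$ whose graph lies in the $c$-subgradient $\partial^c\varphi$ of a $c$-class function $\varphi:X\to[-\infty,\infty]$ (i.e. $\pi$ is concentrated on $\partial^c\varphi$).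
   Context: $\mathbb 1_{u}$ denotes the unit point mass at $u$. $\mu$ is $c$-regular if for any $y_1\ne y_0\in Y$ and $t\in\mathbb R$, $\mu(\{z\in X:\ c(z,y_1)-c(z,y_0)=t\})=0$ (the set consists of points $z$ where both values are finite). $\mu,\nu$ are $c$-compatible if $\mu(A)+\nu(\{y\in Y:\ \forall x\in A,\ c(x,y)=\infty\})\le1$ for every measurable $A\subset X$; they are strongly $c$-compatible if they are $c$-compatible and this inequality is strict for every measurable $A\subset X$ with $0<\mu(A)<1$. $\Pi(\mu,\nu)$ is the set of probability measures on $X\times Y$ with marginals $\mu,\nu$; $\pi$ is optimal if it attains $\inf_{\pi\in\Pi(\mu,\nu)}\int c\,d\pi$. The $c$-transforms are $\psi^c(x)=\inf_{y\in Y}(c(x,y)-\psi(y))$ and $\varphi^c(y)=\inf_{x\in X}(c(x,y)-\varphi(x))$, with the convention $\infty-\infty=+\infty$. The $c$-class (of functions on $X$) is $\{\psi^c:\ \psi:Y\to[-\infty,\infty]\}$. For such $\varphi$, $\partial^c\varphi=\{(x,y):\ \varphi(x)+\varphi^c(y)=c(x,y)\text{ and }c(x,y)<\infty\}$. *)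

theory Defs
  imports "HOL-Probability.Probability"
begin

text \<open>
  The ambient space \<open>X\<close> is a type of class \<^class>\<open>polish_space\<close> with its Borel sigma-algebra;
  \<open>Y\<close> is a set of points. Costs are functions into \<^typ>\<open>ereal\<close>. In \<^typ>\<open>ereal\<close> we have
  \<open>\<infinity> - \<infinity> = \<infinity>\<close> and \<open>\<infinity> + (-\<infinity>) = -\<infinity> + \<infinity> = \<infinity>\<close>, which is the convention used for \<open>c\<close>-transforms.
\<close>

definition c_regular :: "'b set \<Rightarrow> ('a \<Rightarrow> 'b \<Rightarrow> ereal) \<Rightarrow> 'a measure \<Rightarrow> bool" where
  "c_regular Y c \<mu> \<longleftrightarrow>
     (\<forall>y\<^sub>1\<in>Y. \<forall>y\<^sub>0\<in>Y. y\<^sub>1 \<noteq> y\<^sub>0 \<longrightarrow>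
        (\<forall>t::real. {z \<in> space \<mu>. \<bar>c z y\<^sub>1\<bar> \<noteq> \<infinity> \<and> \<bar>c z y\<^sub>0\<bar> \<noteq> \<infinity> \<and> c z y\<^sub>1 - c z y\<^sub>0 = ereal t}
            \<in> null_sets \<mu>))"

definition c_compatible :: "('a \<Rightarrow> 'b \<Rightarrow> ereal) \<Rightarrow> 'a measure \<Rightarrow> 'b measure \<Rightarrow> bool" where
  "c_compatible c \<mu> \<nu> \<longleftrightarrow>
     (\<forall>A\<in>sets \<mu>. measure \<mu> A + measure \<nu> {y \<in> space \<nu>. \<forall>x\<in>A. c x y = \<infinity>} \<le> 1)"

definition strongly_c_compatible :: "('a \<Rightarrow> 'b \<Rightarrow> ereal) \<Rightarrow> 'a measure \<Rightarrow> 'b measure \<Rightarrow> bool" where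
  "strongly_c_compatible c \<mu> \<nu> \<longleftrightarrow>
     c_compatible c \<mu> \<nu> \<and>
     (\<forall>A\<in>sets \<mu>. 0 < measure \<mu> A \<and> measure \<mu> A < 1 \<longrightarrow>
        measure \<mu> A + measure \<nu> {y \<in> space \<nu>. \<forall>x\<in>A. c x y = \<infinity>} < 1)"

definition transport_plans :: "'a measure \<Rightarrow> 'b measure \<Rightarrow> ('a \<times> 'b) measure set" where
  "transport_plans \<mu> \<nu> =
     {\<pi>. prob_space \<pi> \<and> sets \<pi> = sets (\<mu> \<Otimes>\<^sub>M \<nu>) \<and> distr \<pi> \<mu> fst = \<mu> \<and> distr \<pi> \<nu> snd = \<nu>}"

text \<open>
  The cost of a plan is the extended integral, positive part minus negative part
  (\<^const>\<open>e2ennreal\<close> truncates at zero); it is \<open>\<infinity>\<close> when both parts are infinite.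
\<close>

definition transport_cost :: "('a \<Rightarrow> 'b \<Rightarrow> ereal) \<Rightarrow> ('a \<times> 'b) measure \<Rightarrow> ereal" where
  "transport_cost c \<pi> =
     enn2ereal (\<integral>\<^sup>+p. e2ennreal (c (fst p) (snd p)) \<partial>\<pi>) -
     enn2ereal (\<integral>\<^sup>+p. e2ennreal (- c (fst p) (snd p)) \<partial>\<pi>)"

definition optimal_plan ::
  "('a \<Rightarrow> 'b \<Rightarrow> ereal) \<Rightarrow> 'a measure \<Rightarrow> 'b measure \<Rightarrow> ('a \<times> 'b) measure \<Rightarrow> bool" where
  "optimal_plan c \<mu> \<nu> \<pi> \<longleftrightarrow>
     \<pi> \<in> transport_plans \<mu> \<nu> \<and>
     transport_cost c \<pi> = (INF \<pi>'\<in>transport_plans \<mu> \<nu>. transport_cost c \<pi>')"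

definition c_transform_Y :: "'b set \<Rightarrow> ('a \<Rightarrow> 'b \<Rightarrow> ereal) \<Rightarrow> ('b \<Rightarrow> ereal) \<Rightarrow> 'a \<Rightarrow> ereal" where
  "c_transform_Y Y c \<psi> x = (INF y\<in>Y. c x y - \<psi> y)"

definition c_transform_X :: "('a \<Rightarrow> 'b \<Rightarrow> ereal) \<Rightarrow> ('a \<Rightarrow> ereal) \<Rightarrow> 'b \<Rightarrow> ereal" where
  "c_transform_X c \<phi> y = (INF x. c x y - \<phi> x)"

definition c_class :: "'b set \<Rightarrow> ('a \<Rightarrow> 'b \<Rightarrow> ereal) \<Rightarrow> ('a \<Rightarrow> ereal) set" where
  "c_class Y c = {c_transform_Y Y c \<psi> |\<psi>. True}"

definition c_subgradient ::
  "'b set \<Rightarrow> ('a \<Rightarrow> 'b \<Rightarrow> ereal) \<Rightarrow> ('a \<Rightarrow> ereal) \<Rightarrow> ('a \<times> 'b) set" where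
  "c_subgradient Y c \<phi> =
     {(x, y). y \<in> Y \<and> \<phi> x + c_transform_X c \<phi> y = c x y \<and> c x y < \<infinity>}"

end

theory Submission
  imports Defs
begin

text \<open>
  The proof maximises the Kantorovich dual, which for a finite target is a function of finitely many
  real weights. Keep only the points \<open>u i\<close> of positive mass, write \<open>a i x\<close> for \<open>c x (u i)\<close>, and
  for weights \<open>\<psi>\<close> let \<open>pot \<psi> x\<close> be the minimum over \<open>i\<close> of \<open>a i x - \<psi> i\<close>, with
  \<open>cell \<psi> i\<close> the set of points at which the \<open>i\<close>-th term is finite and attains it (a generalised
  Laguerre cell). If weights can be found for which every cell has mass \<open>\<alpha> i\<close>, then sending each
  point to the \<open>u i\<close> of a cell containing it is a transport map, and its graph lies in
  the \<open>c\<close>-subgradient of the \<open>c\<close>-transform of \<open>\<psi>\<close>, with weight \<open>-\<infinity>\<close> at the points of mass zero.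

  Such weights are the maximisers of
  \<open>dual \<psi> = \<integral> (pot \<psi> - pot 0) d\<mu> + (\<Sum>i. \<alpha> i * \<psi> i)\<close>. Subtracting \<open>pot 0\<close> makes the
  integrand bounded, so that no integrability of the cost is involved. Raising \<open>\<psi> i\<close> by \<open>e\<close> costs
  the integral at most \<open>e\<close> times the mass of the raised cell and gains \<open>e * \<alpha> i\<close>; at a maximiser
  the raised cell must therefore carry at least \<open>\<alpha> i\<close>, and letting \<open>e\<close> tend to zero so does
  \<open>cell \<psi> i\<close>. By \<open>c\<close>-regularity two cells overlap in a null set, so the masses of the cells add
  up to at most one, which is the sum of the \<open>\<alpha> i\<close>: all the inequalities are equalities
  (\<open>cell_prob_eq\<close>).

  Strong compatibility makes the maximum exist. Applied to the set where \<open>a i\<close> is infinite for every \<open>i\<close>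
  in a proper nonempty set \<open>J\<close> of indices, it gives a strict Hall condition: the points from which
  \<open>J\<close> is reachable at finite cost have mass more than \<open>\<alpha> J\<close>. Hence, if the weights in \<open>J\<close>
  exceed the others by a large gap, most of those points are assigned to \<open>J\<close>, too much mass lands
  there, and lowering the weights in \<open>J\<close> increases \<open>dual\<close> (\<open>dual_lower\<close>). A maximiser over a big
  box, normalised to have minimum zero, thus has no large gap, hence bounded spread, and stays away
  from the upper faces of the box (\<open>exists_cells_with_masses\<close>).

  Optimality of the plan is complementary slackness, with a case distinction because \<open>pot \<psi>\<close> need
  not be integrable (\<open>optimal_plan_of_potentials\<close>).
\<close>

section \<open>Gaps in finite families of reals\<close>

text \<open>
  Pigeonhole: the \<open>card I\<close> intervals \<open>(k * L, (k + 1) * L]\<close> with \<open>k < card I\<close> can contain only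
  values at the \<open>card I - 1\<close> indices other than \<open>z\<close>, so one of them contains no value.
\<close>

lemma exists_value_gap:
  fixes f :: "'i \<Rightarrow> real"
  assumes fin: "finite I" and L: "0 < L"
    and z: "z \<in> I" "f z \<le> 0" and b: "b \<in> I" "real (card I) * L < f b"
  obtains t where "0 \<le> t" "t + L < f b" "\<And>i. i \<in> I \<Longrightarrow> f i \<le> t \<or> t + L < f i"
proof -
  \<comment> \<open>The index of the interval that contains \<open>f i\<close>, for \<open>f i > 0\<close>.\<close>
  let ?k = "\<lambda>i. nat (\<lceil>f i / L\<rceil> - 1)"
  have "card (?k ` (I - {z})) \<le> card (I - {z})" using fin by (intro card_image_le) simp
  also have "\<dots> < card I" using fin z(1) by (intro card_Diff1_less)
  finally have "\<not> {..<card I} \<subseteq> ?k ` (I - {z})"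
    using card_mono[of "?k ` (I - {z})" "{..<card I}"] fin by auto
  then obtain k where k: "k < card I" "k \<notin> ?k ` (I - {z})" by auto
  show thesis
  proof (rule that[of "real k * L"])
    have "(real k + 1) * L \<le> real (card I) * L"
      using k(1) L by (intro mult_right_mono) auto
    then have "real k * L + L \<le> real (card I) * L" by (simp add: algebra_simps)
    then show "real k * L + L < f b" using b(2) by simp
    fix i assume i: "i \<in> I"
    show "f i \<le> real k * L \<or> real k * L + L < f i"
    proof (rule ccontr)
      assume "\<not> ?thesis"
      then have *: "real k * L < f i" "f i \<le> real k * L + L" by auto
      then have "real k < f i / L" "f i / L \<le> real k + 1"
        using L by (simp_all add: field_simps)
      then have "\<lceil>f i / L\<rceil> = int k + 1" by (simp add: ceiling_eq_iff)
      then have "?k i = k" by simp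
      moreover have "0 \<le> real k * L" using L by simp
      then have "0 < f i" using *(1) by linarith
      then have "i \<noteq> z" using z(2) by auto
      ultimately show False using k(2) i by auto
    qed
  qed (use L in simp)
qed

section \<open>The semidiscrete transport problem\<close>

text \<open>
  The target is represented by its index set, and the cost by its slices \<open>a i\<close>. The assumption
  \<open>strict_Hall\<close> is what strong compatibility amounts to here, and \<open>ties_null\<close> is
  \<open>c\<close>-regularity.
\<close>

locale semidiscrete = prob_space M for M :: "'x measure" +
  fixes I :: "'i set" and a :: "'i \<Rightarrow> 'x \<Rightarrow> ereal" and \<alpha> :: "'i \<Rightarrow> real"
  assumes finite_I: "finite I" and nonempty_I: "I \<noteq> {}"
    and a_measurable: "\<And>i. i \<in> I \<Longrightarrow> a i \<in> borel_measurable M"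
    and a_gt_minf: "\<And>i x. i \<in> I \<Longrightarrow> a i x > -\<infinity>"
    and sum_\<alpha>: "(\<Sum>i\<in>I. \<alpha> i) = 1"
    and AE_cover: "AE x in M. \<exists>i\<in>I. a i x < \<infinity>"
    and strict_Hall: "\<And>J. J \<subset> I \<Longrightarrow> J \<noteq> {} \<Longrightarrow>
      (\<Sum>i\<in>J. \<alpha> i) < prob {x \<in> space M. \<exists>i\<in>J. a i x < \<infinity>}"
    and ties_null: "\<And>i j t. i \<in> I \<Longrightarrow> j \<in> I \<Longrightarrow> i \<noteq> j \<Longrightarrow>
      AE x in M. \<not> (\<bar>a i x\<bar> \<noteq> \<infinity> \<and> \<bar>a j x\<bar> \<noteq> \<infinity> \<and> a i x - a j x = ereal t)"
begin

text \<open>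
  The \<open>c\<close>-transform of the weights as a real number. It is the true infimum at every point that
  reaches some index at finite cost; elsewhere the infimum is \<open>\<infinity>\<close> and the value is the default 0,
  so that all differences of such transforms are finite everywhere.
\<close>

definition pot :: "('i \<Rightarrow> real) \<Rightarrow> 'x \<Rightarrow> real" where
  "pot \<psi> x = real_of_ereal (INF i\<in>I. a i x - ereal (\<psi> i))"

text \<open>
  Since \<open>pot\<close> is real, the equation forces \<open>a i x\<close> to be finite: points that reach nothing lie in no
  cell, despite the default value of \<open>pot\<close> there.
\<close>

definition cell :: "('i \<Rightarrow> real) \<Rightarrow> 'i \<Rightarrow> 'x set" where
  "cell \<psi> i = {x \<in> space M. a i x = ereal (pot \<psi> x + \<psi> i)}"

definition dual :: "('i \<Rightarrow> real) \<Rightarrow> real" where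
  "dual \<psi> = (\<integral>x. pot \<psi> x - pot (\<lambda>_. 0) x \<partial>M) + (\<Sum>i\<in>I. \<alpha> i * \<psi> i)"

text \<open>
  The points that prefer an index in \<open>J\<close> as soon as the weights in \<open>J\<close> exceed the remaining ones
  by \<open>L\<close>.
\<close>

definition reach :: "real \<Rightarrow> 'i set \<Rightarrow> 'x set" where
  "reach L J = {x \<in> space M. \<exists>i\<in>J. a i x < \<infinity> \<and> (\<forall>j\<in>I - J. a i x \<le> a j x + ereal L)}"

lemma pot_measurable [measurable]: "pot \<psi> \<in> borel_measurable M"
proof -
  have "(\<lambda>x. INF i\<in>I. a i x - ereal (\<psi> i)) \<in> borel_measurable M"
    using finite_I a_measurable by (intro borel_measurable_INF) (auto simp: countable_finite)
  then show ?thesis unfolding pot_def[abs_def] by simp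
qed

lemma INF_eq_pot:
  assumes "\<exists>i\<in>I. a i x < \<infinity>"
  shows "(INF i\<in>I. a i x - ereal (\<psi> i)) = ereal (pot \<psi> x)"
proof -
  let ?f = "\<lambda>i. a i x - ereal (\<psi> i)"
  obtain k where k: "k \<in> I" "?f k = (INF i\<in>I. ?f i)"
    using finite_I nonempty_I
    by (metis (no_types, lifting) Min_Inf Min_in finite_imageI image_iff image_is_empty)
  obtain i where i: "i \<in> I" "a i x < \<infinity>" using assms by auto
  have "(INF i\<in>I. ?f i) \<le> ?f i" using i by (auto intro: INF_lower)
  also have "\<dots> < \<infinity>" using i by (cases "a i x") auto
  finally have "(INF i\<in>I. ?f i) < \<infinity>" .
  moreover have "?f k > -\<infinity>" using a_gt_minf[OF k(1), of x] by (cases "a k x") auto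
  ultimately show ?thesis unfolding pot_def using k(2) by (cases "INF i\<in>I. ?f i") auto
qed

lemma pot_le:
  assumes "\<exists>i\<in>I. a i x < \<infinity>" "j \<in> I"
  shows "ereal (pot \<psi> x + \<psi> j) \<le> a j x"
proof -
  have "ereal (pot \<psi> x) \<le> a j x - ereal (\<psi> j)"
    using INF_lower[OF assms(2), of "\<lambda>i. a i x - ereal (\<psi> i)"] INF_eq_pot[OF assms(1)] by simp
  then show ?thesis by (cases "a j x") auto
qed

lemma pot_attained:
  assumes "\<exists>i\<in>I. a i x < \<infinity>"
  obtains i where "i \<in> I" "a i x = ereal (pot \<psi> x + \<psi> i)"
proof -
  let ?f = "\<lambda>i. a i x - ereal (\<psi> i)"
  obtain k where k: "k \<in> I" "?f k = (INF i\<in>I. ?f i)"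
    using finite_I nonempty_I
    by (metis (no_types, lifting) Min_Inf Min_in finite_imageI image_iff image_is_empty)
  then have "a k x = ereal (pot \<psi> x + \<psi> k)"
    using INF_eq_pot[OF assms, of \<psi>] by (cases "a k x") auto
  with k that show thesis by blast
qed

lemma pot_uncovered:
  assumes "\<not> (\<exists>i\<in>I. a i x < \<infinity>)"
  shows "pot \<psi> x = 0"
proof -
  have "(INF i\<in>I. a i x - ereal (\<psi> i)) = (INF i\<in>I. \<infinity>)"
    using assms by (intro INF_cong) auto
  then show ?thesis using nonempty_I by (simp add: pot_def)
qed

lemma cell_covered: "x \<in> cell \<psi> i \<Longrightarrow> i \<in> I \<Longrightarrow> \<exists>i\<in>I. a i x < \<infinity>"
  by (auto simp: cell_def intro!: bexI[of _ i])

lemma cell_measurable [measurable]: "i \<in> I \<Longrightarrow> cell \<psi> i \<in> sets M"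
  unfolding cell_def using a_measurable[of i] by measurable

text \<open>
  The index that attains the minimum for \<open>\<psi>'\<close> is a competitor for \<open>\<psi>\<close>.
\<close>

lemma pot_mono_shift:
  assumes "\<And>i. i \<in> I \<Longrightarrow> \<psi>' i \<le> \<psi> i + d" "0 \<le> d"
  shows "pot \<psi> x \<le> pot \<psi>' x + d"
proof (cases "\<exists>i\<in>I. a i x < \<infinity>")
  case True
  obtain i where i: "i \<in> I" "a i x = ereal (pot \<psi>' x + \<psi>' i)" using pot_attained[OF True] .
  then have "ereal (pot \<psi> x + \<psi> i) \<le> ereal (pot \<psi>' x + \<psi>' i)"
    using pot_le[OF True i(1), of \<psi>] by simp
  then show ?thesis using assms(1)[OF i(1)] by simp
qed (use assms in \<open>simp add: pot_uncovered\<close>)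

lemma pot_lipschitz: "\<bar>pot \<psi> x - pot \<psi>' x\<bar> \<le> (\<Sum>i\<in>I. \<bar>\<psi> i - \<psi>' i\<bar>)"
proof -
  let ?d = "\<Sum>i\<in>I. \<bar>\<psi> i - \<psi>' i\<bar>"
  have d: "\<bar>\<psi> i - \<psi>' i\<bar> \<le> ?d" if "i \<in> I" for i
    by (rule member_le_sum[OF that, of "\<lambda>i. \<bar>\<psi> i - \<psi>' i\<bar>"]) (use finite_I in auto)
  have "0 \<le> ?d" by (simp add: sum_nonneg)
  have "pot \<psi> x \<le> pot \<psi>' x + ?d"
    by (rule pot_mono_shift[OF _ \<open>0 \<le> ?d\<close>]) (use d in fastforce)
  moreover have "pot \<psi>' x \<le> pot \<psi> x + ?d"
    by (rule pot_mono_shift[OF _ \<open>0 \<le> ?d\<close>]) (use d in fastforce)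
  ultimately show ?thesis by linarith
qed

lemma integrable_pot_diff: "integrable M (\<lambda>x. pot \<psi> x - pot \<psi>' x)"
  by (rule integrable_const_bound[where B = "\<Sum>i\<in>I. \<bar>\<psi> i - \<psi>' i\<bar>"])
     (use pot_lipschitz in auto)

section \<open>The dual functional\<close>

lemma dual_diff:
  "dual \<psi> - dual \<psi>' = (\<integral>x. pot \<psi> x - pot \<psi>' x \<partial>M) + (\<Sum>i\<in>I. \<alpha> i * (\<psi> i - \<psi>' i))"
proof -
  have "(\<integral>x. pot \<psi> x - pot \<psi>' x \<partial>M) =
      (\<integral>x. (pot \<psi> x - pot (\<lambda>_. 0) x) - (pot \<psi>' x - pot (\<lambda>_. 0) x) \<partial>M)"
    by simp
  also have "\<dots> = (\<integral>x. pot \<psi> x - pot (\<lambda>_. 0) x \<partial>M) - (\<integral>x. pot \<psi>' x - pot (\<lambda>_. 0) x \<partial>M)"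
    by (rule Bochner_Integration.integral_diff) (rule integrable_pot_diff)+
  finally show ?thesis
    by (simp add: dual_def sum_subtractf right_diff_distrib)
qed

text \<open>
  A Lipschitz bound by finitely many coordinates gives continuity for the product topology on
  \<open>'i \<Rightarrow> real\<close>, in which boxes are compact.
\<close>

lemma continuous_dual: "continuous_on S dual"
  unfolding continuous_on_def
proof (intro ballI)
  fix \<psi> :: "'i \<Rightarrow> real"
  let ?B = "\<lambda>\<psi>'. (\<Sum>i\<in>I. \<bar>\<psi>' i - \<psi> i\<bar>) + (\<Sum>i\<in>I. \<bar>\<alpha> i * (\<psi>' i - \<psi> i)\<bar>)"
  have bound: "\<bar>dual \<psi>' - dual \<psi>\<bar> \<le> ?B \<psi>'" for \<psi>'
  proof -
    have "\<bar>\<integral>x. pot \<psi>' x - pot \<psi> x \<partial>M\<bar> \<le> (\<integral>x. \<bar>pot \<psi>' x - pot \<psi> x\<bar> \<partial>M)"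
      by (rule integral_abs_bound)
    also have "\<dots> \<le> (\<integral>x. (\<Sum>i\<in>I. \<bar>\<psi>' i - \<psi> i\<bar>) \<partial>M)"
      by (rule integral_mono) (use integrable_pot_diff pot_lipschitz in auto)
    also have "\<dots> = (\<Sum>i\<in>I. \<bar>\<psi>' i - \<psi> i\<bar>)" by (simp add: prob_space)
    finally show ?thesis
      using sum_abs[of "\<lambda>i. \<alpha> i * (\<psi>' i - \<psi> i)" I] unfolding dual_diff by linarith
  qed
  have coord: "((\<lambda>\<psi>'. \<psi>' i) \<longlongrightarrow> \<psi> i) (at \<psi> within S)" for i
    by (metis UNIV_I continuous_on_def continuous_on_product_coordinates tendsto_within_subset
        subset_UNIV)
  have "(?B \<longlongrightarrow> (\<Sum>i\<in>I. \<bar>\<psi> i - \<psi> i\<bar>) + (\<Sum>i\<in>I. \<bar>\<alpha> i * (\<psi> i - \<psi> i)\<bar>)) (at \<psi> within S)"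
    by (intro tendsto_intros coord)
  then have "(?B \<longlongrightarrow> 0) (at \<psi> within S)" by simp
  then have "((\<lambda>\<psi>'. dual \<psi>' - dual \<psi>) \<longlongrightarrow> 0) (at \<psi> within S)"
    by (rule Lim_null_comparison[rotated]) (use bound in \<open>auto intro!: always_eventually\<close>)
  then show "(dual \<longlongrightarrow> dual \<psi>) (at \<psi> within S)" by (simp add: LIM_zero_iff)
qed

lemma pot_raise:
  assumes "0 \<le> e"
  shows "pot \<psi> x \<le> pot (\<psi>(i := \<psi> i + e)) x + e"
  by (rule pot_mono_shift) (use assms in auto)

section \<open>Masses of the cells at a maximiser\<close>

text \<open>
  The first-order condition without derivatives. Raising one weight lowers \<open>pot\<close> only on the
  \<^emph>\<open>new\<close> cell, and there by at most \<open>e\<close>; this is why the conclusion is about the raised cell.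
\<close>

lemma dual_maximal_imp_cell_ge:
  assumes i: "i \<in> I" and e: "0 < e" and max: "dual (\<psi>(i := \<psi> i + e)) \<le> dual \<psi>"
  shows "\<alpha> i \<le> prob (cell (\<psi>(i := \<psi> i + e)) i)"
proof -
  let ?\<psi>' = "\<psi>(i := \<psi> i + e)"
  have "- e * indicator (cell ?\<psi>' i) x \<le> pot ?\<psi>' x - pot \<psi> x" if "x \<in> space M" for x
  proof (cases "\<exists>i\<in>I. a i x < \<infinity>")
    case True
    obtain j where j: "j \<in> I" "a j x = ereal (pot ?\<psi>' x + ?\<psi>' j)" using pot_attained[OF True] .
    show ?thesis
    proof (cases "j = i")
      case True
      then have "x \<in> cell ?\<psi>' i" using j that by (simp add: cell_def)
      then show ?thesis using pot_raise[of e \<psi> x i] e by simp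
    next
      case False
      then have "pot \<psi> x \<le> pot ?\<psi>' x" using pot_le[OF True j(1), of \<psi>] j(2) by simp
      moreover have "0 \<le> e * indicator (cell ?\<psi>' i) x" using e by simp
      ultimately show ?thesis by linarith
    qed
  qed (use e in \<open>simp add: pot_uncovered\<close>)
  then have "(\<integral>x. - e * indicator (cell ?\<psi>' i) x \<partial>M) \<le> (\<integral>x. pot ?\<psi>' x - pot \<psi> x \<partial>M)"
    using i by (intro integral_mono integrable_pot_diff integrable_mult_right
        integrable_real_indicator) (auto simp: less_top[symmetric])
  moreover have "(\<integral>x. - e * indicator (cell ?\<psi>' i) x \<partial>M) = - e * prob (cell ?\<psi>' i)"
    using i by simp
  moreover have "(\<Sum>j\<in>I. \<alpha> j * (?\<psi>' j - \<psi> j)) = (\<Sum>j\<in>I. if j = i then \<alpha> j * e else 0)"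
    by (rule sum.cong) auto
  ultimately have "e * (\<alpha> i - prob (cell ?\<psi>' i)) \<le> 0"
    using max dual_diff[of ?\<psi>' \<psi>] finite_I i by (simp add: algebra_simps)
  then show ?thesis using e by (simp add: mult_le_0_iff)
qed

lemma cell_raise_mono:
  assumes i: "i \<in> I" and e: "e \<le> e'"
  shows "cell (\<psi>(i := \<psi> i + e)) i \<subseteq> cell (\<psi>(i := \<psi> i + e')) i"
proof
  fix x assume x: "x \<in> cell (\<psi>(i := \<psi> i + e)) i"
  let ?\<psi> = "\<psi>(i := \<psi> i + e)" and ?\<psi>' = "\<psi>(i := \<psi> i + e')"
  have "pot ?\<psi> x \<le> pot ?\<psi>' x + (e' - e)" using pot_raise[of "e' - e" ?\<psi> x i] e by simp
  moreover have "ereal (pot ?\<psi>' x + ?\<psi>' i) \<le> a i x" by (rule pot_le[OF cell_covered[OF x i] i])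
  ultimately show "x \<in> cell ?\<psi>' i" using x by (auto simp: cell_def)
qed

text \<open>
  Cells are defined by closed conditions, so they survive the limit \<open>e \<longrightarrow> 0\<close>.
\<close>

lemma raised_cells_subset_cell:
  assumes "i \<in> I"
  shows "(\<Inter>n. cell (\<psi>(i := \<psi> i + 1 / real (Suc n))) i) \<subseteq> cell \<psi> i"
proof
  fix x assume x: "x \<in> (\<Inter>n. cell (\<psi>(i := \<psi> i + 1 / real (Suc n))) i)"
  let ?\<psi> = "\<lambda>n. \<psi>(i := \<psi> i + 1 / real (Suc n))"
  have eq: "a i x = ereal (pot (?\<psi> n) x + (\<psi> i + 1 / real (Suc n)))" for n
    using x by (auto simp: cell_def)
  have lim0: "(\<lambda>n. 1 / real (Suc n)) \<longlonglongrightarrow> 0"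
    using LIMSEQ_inverse_real_of_nat by (simp add: inverse_eq_divide)
  have "\<bar>pot (?\<psi> n) x - pot \<psi> x\<bar> \<le> 1 / real (Suc n)" for n
  proof -
    have "(\<Sum>j\<in>I. \<bar>?\<psi> n j - \<psi> j\<bar>) = (\<Sum>j\<in>I. if j = i then 1 / real (Suc n) else 0)"
      by (rule sum.cong) auto
    then show ?thesis using pot_lipschitz[of "?\<psi> n" x \<psi>] finite_I assms by simp
  qed
  then have "(\<lambda>n. pot (?\<psi> n) x - pot \<psi> x) \<longlonglongrightarrow> 0"
    by (intro Lim_null_comparison[OF _ lim0]) (auto intro!: always_eventually)
  then have "(\<lambda>n. pot (?\<psi> n) x + (\<psi> i + 1 / real (Suc n))) \<longlonglongrightarrow> pot \<psi> x + (\<psi> i + 0)"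
    by (intro tendsto_add tendsto_const lim0) (simp add: LIM_zero_iff)
  moreover have "pot (?\<psi> n) x + (\<psi> i + 1 / real (Suc n)) = real_of_ereal (a i x)" for n
    by (simp only: eq[of n] real_of_ereal.simps)
  ultimately have "real_of_ereal (a i x) = pot \<psi> x + \<psi> i"
    by (simp only: LIMSEQ_const_iff add_0_right)
  then show "x \<in> cell \<psi> i" using eq[of 0] x by (auto simp: cell_def)
qed

lemma AE_cell_unique:
  "AE x in M. \<forall>i\<in>I. \<forall>j\<in>I. x \<in> cell \<psi> i \<longrightarrow> x \<in> cell \<psi> j \<longrightarrow> i = j"
proof -
  have "AE x in M. x \<in> cell \<psi> i \<longrightarrow> x \<in> cell \<psi> j \<longrightarrow> i = j" if "i \<in> I" "j \<in> I" for i j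
  proof (cases "i = j")
    case False
    show ?thesis
      using ties_null[OF that False, of "\<psi> i - \<psi> j"]
      by eventually_elim (auto simp: cell_def)
  qed simp
  then show ?thesis using finite_I by (intro AE_finite_allI) auto
qed

lemma AE_exists_cell: "AE x in M. \<exists>i\<in>I. x \<in> cell \<psi> i"
  using AE_cover AE_space
proof eventually_elim
  case (elim x)
  then show ?case using pot_attained[of x \<psi>] by (auto simp: cell_def)
qed

lemma sum_prob_cell_le_1: "(\<Sum>i\<in>I. prob (cell \<psi> i)) \<le> 1"
proof -
  have "AE x in M. (\<Sum>i\<in>I. indicator (cell \<psi> i) x) \<le> (1::real)"
    using AE_cell_unique[of \<psi>]
  proof eventually_elim
    case (elim x)
    have "card {i \<in> I. x \<in> cell \<psi> i} \<le> 1"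
      using elim finite_I by (auto simp: card_le_Suc0_iff_eq)
    then show ?case using finite_I by (simp add: indicator_def sum.If_cases Int_def)
  qed
  then have "(\<integral>x. (\<Sum>i\<in>I. indicator (cell \<psi> i) x) \<partial>M) \<le> (\<integral>x. (1::real) \<partial>M)"
    by (intro integral_mono_AE Bochner_Integration.integrable_sum integrable_real_indicator)
       (auto simp: less_top[symmetric])
  then show ?thesis by (simp add: prob_space Bochner_Integration.integral_sum less_top[symmetric])
qed

text \<open>
  Each cell has at least its prescribed mass, and the total leaves no room for excess. Only
  raising a weight is tested, so maximality against upward perturbations of bounded size suffices.
\<close>

lemma cell_prob_eq:
  assumes max: "\<And>i e. i \<in> I \<Longrightarrow> 0 < e \<Longrightarrow> e \<le> 1 \<Longrightarrow> dual (\<psi>(i := \<psi> i + e)) \<le> dual \<psi>"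
    and i: "i \<in> I"
  shows "prob (cell \<psi> i) = \<alpha> i"
proof -
  have ge: "\<alpha> j \<le> prob (cell \<psi> j)" if j: "j \<in> I" for j
  proof -
    let ?C = "\<lambda>n. cell (\<psi>(j := \<psi> j + 1 / real (Suc n))) j"
    have dec: "decseq ?C"
      unfolding decseq_def by (intro allI impI cell_raise_mono[OF j]) (simp add: frac_le)
    have "(\<lambda>n. prob (?C n)) \<longlonglongrightarrow> prob (\<Inter>n. ?C n)"
      by (rule finite_Lim_measure_decseq[OF _ dec]) (use j in auto)
    then have "\<alpha> j \<le> prob (\<Inter>n. ?C n)"
      by (rule LIMSEQ_le_const)
         (use dual_maximal_imp_cell_ge[OF j _ max[OF j]] in auto)
    also have "\<dots> \<le> prob (cell \<psi> j)"
      by (rule finite_measure_mono[OF raised_cells_subset_cell[OF j]]) (use j in simp)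
    finally show ?thesis .
  qed
  have "(\<Sum>j\<in>I. prob (cell \<psi> j) - \<alpha> j) \<le> 0"
    using sum_prob_cell_le_1[of \<psi>] sum_\<alpha> by (simp add: sum_subtractf)
  moreover have "prob (cell \<psi> i) - \<alpha> i \<le> (\<Sum>j\<in>I. prob (cell \<psi> j) - \<alpha> j)"
    by (rule member_le_sum[OF i, of "\<lambda>j. prob (cell \<psi> j) - \<alpha> j"]) (use ge finite_I in auto)
  ultimately show ?thesis using ge[OF i] by simp
qed

section \<open>Existence of a maximiser\<close>

lemma covered_measurable: "J \<subseteq> I \<Longrightarrow> {x \<in> space M. \<exists>i\<in>J. a i x < \<infinity>} \<in> sets M"
proof -
  assume J: "J \<subseteq> I"
  have "{x \<in> space M. a i x < \<infinity>} \<in> sets M" if "i \<in> I" for i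
    using a_measurable[OF that] by measurable
  then show ?thesis
    using J finite_subset[OF J finite_I] by (intro sets.sets_Collect_finite_Ex) auto
qed

lemma reach_measurable: "J \<subseteq> I \<Longrightarrow> reach L J \<in> sets M"
proof -
  assume J: "J \<subseteq> I"
  have m: "{x \<in> space M. a i x < \<infinity>} \<in> sets M" "{x \<in> space M. a i x \<le> a j x + ereal L} \<in> sets M"
    if "i \<in> I" "j \<in> I" for i j
    using a_measurable[OF that(1)] a_measurable[OF that(2)] by measurable
  show ?thesis
    unfolding reach_def using J finite_subset[OF J finite_I] finite_I m
    by (intro sets.sets_Collect_finite_Ex sets.sets_Collect_conj sets.sets_Collect_finite_All) auto
qed

text \<open>
  On \<open>reach L J\<close> the gap ensures that an index of \<open>J\<close> still attains the minimum after lowering, so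
  \<open>pot\<close> rises there by the full amount \<open>s\<close>, while it decreases nowhere. For \<open>J = I\<close> it says
  that subtracting a constant from all weights does not decrease \<open>dual\<close>.
\<close>

lemma dual_lower:
  assumes J: "J \<subseteq> I" and s: "0 \<le> s"
    and gap: "\<And>i j. i \<in> J \<Longrightarrow> j \<in> I - J \<Longrightarrow> \<psi> j + L \<le> \<psi> i - s"
  defines "\<psi>' \<equiv> \<lambda>i. if i \<in> J then \<psi> i - s else \<psi> i"
  shows "dual \<psi> + s * (prob (reach L J) - (\<Sum>i\<in>J. \<alpha> i)) \<le> dual \<psi>'"
proof -
  have mono: "pot \<psi> x \<le> pot \<psi>' x" for x
    using pot_mono_shift[of \<psi>' \<psi> 0 x] s by (simp add: \<psi>'_def)
  have "s * indicator (reach L J) x \<le> pot \<psi>' x - pot \<psi> x" for x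
  proof (cases "x \<in> reach L J")
    case True
    then obtain i where i: "i \<in> J" "a i x < \<infinity>" "\<And>j. j \<in> I - J \<Longrightarrow> a i x \<le> a j x + ereal L"
      by (auto simp: reach_def)
    then have ex: "\<exists>i\<in>I. a i x < \<infinity>" using J by auto
    obtain j where j: "j \<in> I" "a j x = ereal (pot \<psi>' x + \<psi>' j)" using pot_attained[OF ex] .
    have "pot \<psi> x + s \<le> pot \<psi>' x"
    proof (cases "j \<in> J")
      case True
      then show ?thesis using pot_le[OF ex j(1), of \<psi>] j(2) by (simp add: \<psi>'_def)
    next
      case False
      then have "a i x \<le> ereal (pot \<psi>' x + \<psi> j + L)"
        using i(3)[of j] j by (simp add: \<psi>'_def)
      moreover have "ereal (pot \<psi> x + \<psi> i) \<le> a i x" using pot_le[OF ex, of i] i(1) J by auto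
      ultimately have "ereal (pot \<psi> x + \<psi> i) \<le> ereal (pot \<psi>' x + \<psi> j + L)" by (rule order_trans[rotated])
      then show ?thesis using gap[OF i(1), of j] j(1) False by simp
    qed
    then show ?thesis using True by simp
  qed (use mono in simp)
  then have "(\<integral>x. s * indicator (reach L J) x \<partial>M) \<le> (\<integral>x. pot \<psi>' x - pot \<psi> x \<partial>M)"
    using reach_measurable[OF J] by (intro integral_mono integrable_pot_diff integrable_mult_right
        integrable_real_indicator) (auto simp: less_top[symmetric])
  moreover have "reach L J \<inter> space M = reach L J" by (auto simp: reach_def)
  moreover have "(\<Sum>i\<in>I. \<alpha> i * (\<psi>' i - \<psi> i)) = - s * (\<Sum>i\<in>J. \<alpha> i)"
  proof -
    have "(\<Sum>i\<in>I. \<alpha> i * (\<psi>' i - \<psi> i)) = (\<Sum>i\<in>I. if i \<in> J then - s * \<alpha> i else 0)"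
      by (rule sum.cong) (auto simp: \<psi>'_def)
    also have "\<dots> = (\<Sum>i\<in>J. - s * \<alpha> i)"
      using finite_I J by (simp add: sum.inter_restrict[symmetric] Int_absorb1)
    finally show ?thesis by (simp add: sum_distrib_left)
  qed
  ultimately show ?thesis using dual_diff[of \<psi>' \<psi>] by (simp add: algebra_simps)
qed

lemma reach_tendsto:
  assumes J: "J \<subseteq> I"
  shows "(\<lambda>n. prob (reach (real n) J)) \<longlonglongrightarrow> prob {x \<in> space M. \<exists>i\<in>J. a i x < \<infinity>}"
proof -
  have inc: "incseq (\<lambda>n. reach (real n) J)"
  proof (rule incseq_SucI, rule subsetI)
    fix n x assume "x \<in> reach (real n) J"
    then obtain i where i: "x \<in> space M" "i \<in> J" "a i x < \<infinity>" "\<And>j. j \<in> I - J \<Longrightarrow> a i x \<le> a j x + ereal n"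
      by (auto simp: reach_def)
    have "a i x \<le> a j x + ereal (Suc n)" if "j \<in> I - J" for j
      using i(4)[OF that] by (rule order_trans) (auto intro!: add_left_mono)
    then show "x \<in> reach (real (Suc n)) J" using i by (auto simp: reach_def)
  qed
  have "(\<Union>n. reach (real n) J) = {x \<in> space M. \<exists>i\<in>J. a i x < \<infinity>}"
  proof (intro equalityI subsetI)
    fix x assume "x \<in> {x \<in> space M. \<exists>i\<in>J. a i x < \<infinity>}"
    then obtain i where i: "x \<in> space M" "i \<in> J" "a i x < \<infinity>" by auto
    have "\<forall>\<^sub>F n in sequentially. a i x \<le> a j x + ereal (real n)" if j: "j \<in> I - J" for j
    proof -
      obtain r where r: "a i x = ereal r" using i(2,3) J a_gt_minf[of i x] by (cases "a i x") auto
      have "\<forall>\<^sub>F n in sequentially. r - real_of_ereal (a j x) \<le> real n"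
        by (rule filterlim_at_top[THEN iffD1, rule_format, OF filterlim_real_sequentially])
      then show ?thesis
      proof eventually_elim
        case (elim n)
        then show ?case using r j a_gt_minf[of j x] by (cases "a j x") auto
      qed
    qed
    then have "\<forall>\<^sub>F n in sequentially. \<forall>j\<in>I - J. a i x \<le> a j x + ereal (real n)"
      using finite_I by (intro eventually_ball_finite) auto
    then obtain n where "\<forall>j\<in>I - J. a i x \<le> a j x + ereal (real n)"
      using eventually_happens'[OF sequentially_bot] by blast
    then show "x \<in> (\<Union>n. reach (real n) J)" using i by (auto simp: reach_def)
  qed (auto simp: reach_def)
  then show ?thesis
    using finite_Lim_measure_incseq[OF _ inc] reach_measurable[OF J] by auto
qed

text \<open>
  A single gap size serves all index sets: \<open>reach n J\<close> increases to the set of points from which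
  \<open>J\<close> is reachable, the Hall condition is strict, and there are finitely many \<open>J\<close>.
\<close>

lemma exists_reach_bound:
  obtains L where "1 \<le> L" "\<And>J. J \<subset> I \<Longrightarrow> J \<noteq> {} \<Longrightarrow> (\<Sum>i\<in>J. \<alpha> i) < prob (reach L J)"
proof -
  have "\<forall>\<^sub>F n in sequentially. (\<Sum>i\<in>J. \<alpha> i) < prob (reach (real n) J)"
    if "J \<in> {J. J \<subset> I \<and> J \<noteq> {}}" for J
    using order_tendstoD(1)[OF reach_tendsto strict_Hall] that by blast
  moreover have "finite {J. J \<subset> I \<and> J \<noteq> {}}"
    by (rule finite_subset[of _ "Pow I"]) (use finite_I in auto)
  ultimately have "\<forall>\<^sub>F n in sequentially. \<forall>J\<in>{J. J \<subset> I \<and> J \<noteq> {}}. (\<Sum>i\<in>J. \<alpha> i) < prob (reach (real n) J)"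
    by (intro eventually_ball_finite) auto
  then have "\<forall>\<^sub>F n in sequentially. 1 \<le> n \<and>
      (\<forall>J\<in>{J. J \<subset> I \<and> J \<noteq> {}}. (\<Sum>i\<in>J. \<alpha> i) < prob (reach (real n) J))"
    using eventually_ge_at_top[of 1] by eventually_elim auto
  then obtain n :: nat where "1 \<le> n" "\<forall>J\<in>{J. J \<subset> I \<and> J \<noteq> {}}. (\<Sum>i\<in>J. \<alpha> i) < prob (reach (real n) J)"
    using eventually_happens'[OF sequentially_bot] by blast
  then show thesis using that[of "real n"] by auto
qed

lemma prob_reach_I: "prob (reach L I) = 1"
proof -
  have "reach L I = {x \<in> space M. \<exists>i\<in>I. a i x < \<infinity>}" by (auto simp: reach_def)
  then show ?thesis using prob_Collect_eq_1[OF covered_measurable[OF order_refl]] AE_cover by simp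
qed

lemma exists_dual_maximal_on_box:
  assumes R: "0 \<le> R"
  obtains \<psi> where "\<And>i. i \<in> I \<Longrightarrow> 0 \<le> \<psi> i \<and> \<psi> i \<le> R" 
    "\<And>\<psi>'. (\<And>i. i \<in> I \<Longrightarrow> 0 \<le> \<psi>' i \<and> \<psi>' i \<le> R) \<Longrightarrow> dual \<psi>' \<le> dual \<psi>"
proof -
  \<comment> \<open>Coordinates outside \<open>I\<close>, which do not influence \<open>dual\<close>, are fixed to make the box compact.\<close>
  let ?B = "Pi\<^sub>E UNIV (\<lambda>i. if i \<in> I then {0..R} else {0})"
  have "compactin (product_topology (\<lambda>i. euclidean) UNIV) ?B"
    unfolding compactin_PiE by (auto simp: compactin_euclidean_iff)
  then have "compact ?B" by (simp add: euclidean_product_topology compactin_euclidean_iff)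
  moreover have "?B \<noteq> {}" using R by (auto simp: PiE_eq_empty_iff split: if_splits)
  ultimately obtain \<psi> where \<psi>: "\<psi> \<in> ?B" "\<forall>\<psi>'\<in>?B. dual \<psi>' \<le> dual \<psi>"
    using continuous_attains_sup[OF _ _ continuous_dual] by metis
  show thesis
  proof (rule that[of \<psi>])
    show "0 \<le> \<psi> i \<and> \<psi> i \<le> R" if "i \<in> I" for i
      using \<psi>(1) that by (auto simp: PiE_iff dest!: spec[of _ i])
    fix \<psi>' assume *: "\<And>i. i \<in> I \<Longrightarrow> 0 \<le> \<psi>' i \<and> \<psi>' i \<le> R"
    let ?\<phi> = "\<lambda>i. if i \<in> I then \<psi>' i else 0"
    have "dual ?\<phi> \<le> dual \<psi>" using \<psi>(2) * by (auto simp: PiE_iff)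
    moreover have "dual ?\<phi> = dual \<psi>'"
      unfolding dual_def pot_def by (simp cong: INF_cong sum.cong)
    ultimately show "dual \<psi>' \<le> dual \<psi>" by simp
  qed
qed

lemma exists_cells_with_masses:
  obtains \<psi> where "\<And>i. i \<in> I \<Longrightarrow> prob (cell \<psi> i) = \<alpha> i"
proof -
  obtain L where L: "1 \<le> L" "\<And>J. J \<subset> I \<Longrightarrow> J \<noteq> {} \<Longrightarrow> (\<Sum>i\<in>J. \<alpha> i) < prob (reach L J)"
    using exists_reach_bound by blast
  \<comment> \<open>The spread of a normalised maximiser is at most \<open>card I * L\<close>; the extra 1 leaves room for raising a weight.\<close>
  define R where "R = real (card I) * L + 1"
  have R: "0 \<le> R" using L(1) by (simp add: R_def)
  obtain \<psi>0 where \<psi>0: "\<And>i. i \<in> I \<Longrightarrow> 0 \<le> \<psi>0 i \<and> \<psi>0 i \<le> R"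
    "\<And>\<psi>'. (\<And>i. i \<in> I \<Longrightarrow> 0 \<le> \<psi>' i \<and> \<psi>' i \<le> R) \<Longrightarrow> dual \<psi>' \<le> dual \<psi>0"
    using exists_dual_maximal_on_box[OF R] by metis
  obtain z where z: "z \<in> I" "\<And>i. i \<in> I \<Longrightarrow> \<psi>0 z \<le> \<psi>0 i"
    using finite_I nonempty_I by (metis arg_min_if_finite(1) arg_min_least)
  define \<psi> where "\<psi> = (\<lambda>i. if i \<in> I then \<psi>0 i - \<psi>0 z else \<psi>0 i)"
  \<comment> \<open>The choice \<open>J = I\<close>, for which the correction term vanishes.\<close>
  have "dual \<psi>0 \<le> dual \<psi>"
    using dual_lower[of I "\<psi>0 z" \<psi>0 L] \<psi>0(1)[OF z(1)] unfolding \<psi>_def prob_reach_I sum_\<alpha> by simp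
  then have max: "dual \<psi>' \<le> dual \<psi>" if "\<And>i. i \<in> I \<Longrightarrow> 0 \<le> \<psi>' i \<and> \<psi>' i \<le> R" for \<psi>'
    using \<psi>0(2)[of \<psi>'] that by fastforce
  have nonneg: "0 \<le> \<psi> i" and le_R: "\<psi> i \<le> R" if "i \<in> I" for i
    using z(2)[OF that] \<psi>0(1)[OF that] \<psi>0(1)[OF z(1)] that by (auto simp: \<psi>_def)
  have \<psi>z: "\<psi> z = 0" using z(1) by (simp add: \<psi>_def)
  have bound: "\<psi> b \<le> real (card I) * L" if b: "b \<in> I" for b
  proof (rule ccontr)
    assume "\<not> ?thesis"
    then obtain t where t: "0 \<le> t" "t + L < \<psi> b" "\<And>i. i \<in> I \<Longrightarrow> \<psi> i \<le> t \<or> t + L < \<psi> i"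
      using exists_value_gap[of I L z \<psi> b] finite_I z(1) \<psi>z b L(1) by auto
    define J where "J = {i \<in> I. t + L < \<psi> i}"
    \<comment> \<open>Lower the upper group as far as possible while keeping a gap of \<open>L\<close>.\<close>
    define s where "s = Min (\<psi> ` J) - (t + L)"
    have J: "J \<subseteq> I" "finite J" "J \<noteq> {}" "z \<notin> J"
      using b t(1,2) finite_I \<psi>z L(1) by (auto simp: J_def)
    have s_le: "s \<le> \<psi> i - (t + L)" if "i \<in> J" for i using that J(2) by (simp add: s_def)
    have "Min (\<psi> ` J) \<in> \<psi> ` J" using J by (intro Min_in) auto
    then have s: "0 < s" by (auto simp: s_def J_def)
    have "dual \<psi> + s * (prob (reach L J) - (\<Sum>i\<in>J. \<alpha> i)) \<le> dual (\<lambda>i. if i \<in> J then \<psi> i - s else \<psi> i)"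
    proof (rule dual_lower)
      fix i j assume "i \<in> J" "j \<in> I - J"
      then show "\<psi> j + L \<le> \<psi> i - s" using s_le[of i] t(3)[of j] by (auto simp: J_def)
    qed (use J s in auto)
    also have "\<dots> \<le> dual \<psi>"
      by (rule max) (use s s_le nonneg le_R t(1) L(1) in \<open>fastforce\<close>)
    finally have "s * (prob (reach L J) - (\<Sum>i\<in>J. \<alpha> i)) \<le> 0" by simp
    moreover have "(\<Sum>i\<in>J. \<alpha> i) < prob (reach L J)" using L(2)[of J] J z(1) by blast
    ultimately show False using s by (simp add: mult_le_0_iff)
  qed
  have "dual (\<psi>(i := \<psi> i + e)) \<le> dual \<psi>" if "i \<in> I" "0 < e" "e \<le> 1" for i e
    by (rule max) (use nonneg bound le_R that in \<open>fastforce simp: R_def\<close>)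
  then show thesis using cell_prob_eq that by blast
qed

end

section \<open>Optimality from potentials\<close>

lemma transport_plansD:
  assumes "\<rho> \<in> transport_plans \<mu> \<nu>"
  shows "prob_space \<rho>" "sets \<rho> = sets (\<mu> \<Otimes>\<^sub>M \<nu>)"
    "distr \<rho> \<mu> fst = \<mu>" "distr \<rho> \<nu> snd = \<nu>"
    "fst \<in> measurable \<rho> \<mu>" "snd \<in> measurable \<rho> \<nu>"
proof -
  show "prob_space \<rho>" and s: "sets \<rho> = sets (\<mu> \<Otimes>\<^sub>M \<nu>)" and "distr \<rho> \<mu> fst = \<mu>" "distr \<rho> \<nu> snd = \<nu>"
    using assms by (auto simp: transport_plans_def)
  show "fst \<in> measurable \<rho> \<mu>" "snd \<in> measurable \<rho> \<nu>"
    using measurable_cong_sets[OF s refl] measurable_fst measurable_snd by blast+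
qed

lemma transport_cost_eq_integral:
  assumes r: "integrable \<rho> r" and eq: "AE p in \<rho>. c (fst p) (snd p) = ereal (r p)"
  shows "transport_cost c \<rho> = ereal (\<integral>p. r p \<partial>\<rho>)"
proof -
  have "(\<integral>\<^sup>+p. e2ennreal (c (fst p) (snd p)) \<partial>\<rho>) = (\<integral>\<^sup>+p. ennreal (r p) \<partial>\<rho>)"
    using eq by (intro nn_integral_cong_AE) (auto elim!: eventually_mono)
  moreover have "(\<integral>\<^sup>+p. e2ennreal (- c (fst p) (snd p)) \<partial>\<rho>) = (\<integral>\<^sup>+p. ennreal (- r p) \<partial>\<rho>)"
    using eq by (intro nn_integral_cong_AE) (auto elim!: eventually_mono)
  moreover obtain x y where "0 \<le> x" "(\<integral>\<^sup>+p. ennreal (r p) \<partial>\<rho>) = ennreal x"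
    "0 \<le> y" "(\<integral>\<^sup>+p. ennreal (- r p) \<partial>\<rho>) = ennreal y"
    using r unfolding real_integrable_def by (metis ennreal_cases infinity_ennreal_def)
  ultimately show ?thesis
    using real_lebesgue_integral_def[OF r] unfolding transport_cost_def by simp
qed

text \<open>
  If \<open>f\<close> is \<open>\<mu>\<close>-integrable then \<open>f + g\<close> has the same integral under all plans, and the claim is
  immediate. In general let \<open>\<rho>\<close> be a competitor; since \<open>g\<close> is bounded, the positive and negative
  parts of the costs control those of \<open>f\<close>. If the positive part of the cost of \<open>\<rho>\<close> is infinite,
  \<open>\<rho>\<close> has cost \<open>\<infinity>\<close>, also when its negative part is infinite. Otherwise \<open>f\<close> has finite positive
  part, so either \<open>\<pi>\<close> has cost \<open>-\<infinity>\<close>, or \<open>f\<close> is integrable.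
\<close>

lemma optimal_plan_of_potentials:
  fixes f :: "'a \<Rightarrow> real" and g :: "'b \<Rightarrow> real"
  assumes plan: "\<pi> \<in> transport_plans \<mu> \<nu>"
    and f: "f \<in> borel_measurable \<mu>" and g: "g \<in> borel_measurable \<nu>"
    and bound: "\<And>y. \<bar>g y\<bar> \<le> B"
    and c: "(\<lambda>p. c (fst p) (snd p)) \<in> borel_measurable (\<mu> \<Otimes>\<^sub>M \<nu>)"
    and eq: "AE p in \<pi>. c (fst p) (snd p) = ereal (f (fst p) + g (snd p))"
    and le: "\<And>\<rho>. \<rho> \<in> transport_plans \<mu> \<nu> \<Longrightarrow>
      AE p in \<rho>. ereal (f (fst p) + g (snd p)) \<le> c (fst p) (snd p)"
  shows "optimal_plan c \<mu> \<nu> \<pi>"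
proof -
  let ?C = "\<lambda>p. c (fst p) (snd p)" and ?h = "\<lambda>p. f (fst p) + g (snd p)"
  define P where "P \<rho> = (\<integral>\<^sup>+p. e2ennreal (?C p) \<partial>\<rho>)" for \<rho>
  define N where "N \<rho> = (\<integral>\<^sup>+p. e2ennreal (- ?C p) \<partial>\<rho>)" for \<rho>
  have B: "0 \<le> B" using bound[of undefined] by linarith
  have cost: "transport_cost c \<rho> = enn2ereal (P \<rho>) - enn2ereal (N \<rho>)" for \<rho>
    by (simp add: transport_cost_def P_def N_def)
  have C_measurable: "?C \<in> borel_measurable \<rho>" if "\<rho> \<in> transport_plans \<mu> \<nu>" for \<rho>
    using c measurable_cong_sets[OF transport_plansD(2)[OF that] refl] by blast
  have f_fst: "(\<lambda>p. f (fst p)) \<in> borel_measurable \<rho>" if "\<rho> \<in> transport_plans \<mu> \<nu>" for \<rho>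
    by (rule measurable_compose[OF transport_plansD(5)[OF that] f])
  have g_snd: "(\<lambda>p. g (snd p)) \<in> borel_measurable \<rho>" if "\<rho> \<in> transport_plans \<mu> \<nu>" for \<rho>
    by (rule measurable_compose[OF transport_plansD(6)[OF that] g])
  have marginal: "(\<integral>\<^sup>+p. k (fst p) \<partial>\<rho>) = (\<integral>\<^sup>+x. k x \<partial>\<mu>)"
    if "\<rho> \<in> transport_plans \<mu> \<nu>" "k \<in> borel_measurable \<mu>" for \<rho> and k :: "'a \<Rightarrow> ennreal"
    using nn_integral_distr[OF transport_plansD(5)[OF that(1)], of k] that(2)
      transport_plansD(3)[OF that(1)] by simp
  have add_B: "(\<integral>\<^sup>+p. k p + ennreal B \<partial>\<rho>) = (\<integral>\<^sup>+p. k p \<partial>\<rho>) + ennreal B"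
    if "\<rho> \<in> transport_plans \<mu> \<nu>" "k \<in> borel_measurable \<rho>" for \<rho> k
    using that prob_space.emeasure_space_1[OF transport_plansD(1)[OF that(1)]]
    by (simp add: nn_integral_add)
  have "transport_cost c \<pi> \<le> transport_cost c \<rho>" if \<rho>: "\<rho> \<in> transport_plans \<mu> \<nu>" for \<rho>
  proof (cases "P \<rho> = \<top>")
    case True
    then show ?thesis unfolding cost[of \<rho>] by (cases "enn2ereal (N \<rho>)") auto
  next
    case P_fin: False
    have "(\<integral>\<^sup>+x. ennreal (f x) \<partial>\<mu>) = (\<integral>\<^sup>+p. ennreal (f (fst p)) \<partial>\<rho>)"
      using marginal[OF \<rho>, of "\<lambda>x. ennreal (f x)"] f by simp
    also have "\<dots> \<le> (\<integral>\<^sup>+p. e2ennreal (?C p) + ennreal B \<partial>\<rho>)"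
    proof (rule nn_integral_mono_AE)
      show "AE p in \<rho>. ennreal (f (fst p)) \<le> e2ennreal (?C p) + ennreal B"
        using le[OF \<rho>]
      proof eventually_elim
        case (elim p)
        have "ennreal (f (fst p)) \<le> ennreal (?h p + B)"
          using bound[of "snd p"] by (intro ennreal_leI) linarith
        also have "\<dots> \<le> ennreal (?h p) + ennreal B"
          using B by (cases "0 \<le> ?h p") (simp_all add: ennreal_neg ennreal_leI flip: ennreal_plus)
        also have "\<dots> \<le> e2ennreal (?C p) + ennreal B"
          using e2ennreal_mono[OF elim] by (intro add_right_mono) simp
        finally show ?case .
      qed
    qed
    also have "\<dots> = P \<rho> + ennreal B"
      unfolding P_def using C_measurable[OF \<rho>] by (intro add_B \<rho>) simp
    also have "\<dots> < \<top>" using P_fin by (simp add: less_top[symmetric])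
    finally have f_pos: "(\<integral>\<^sup>+x. ennreal (f x) \<partial>\<mu>) < \<top>" .
    have "P \<pi> \<le> (\<integral>\<^sup>+p. ennreal (f (fst p)) + ennreal B \<partial>\<pi>)"
      unfolding P_def
    proof (rule nn_integral_mono_AE)
      show "AE p in \<pi>. e2ennreal (?C p) \<le> ennreal (f (fst p)) + ennreal B"
        using eq
      proof eventually_elim
        case (elim p)
        have "e2ennreal (?C p) \<le> ennreal (f (fst p) + B)"
          using elim bound[of "snd p"] by (simp add: ennreal_leI abs_le_iff)
        also have "\<dots> \<le> ennreal (f (fst p)) + ennreal B"
          using B by (cases "0 \<le> f (fst p)") (simp_all add: ennreal_neg ennreal_leI flip: ennreal_plus)
        finally show ?case .
      qed
    qed
    also have "\<dots> = (\<integral>\<^sup>+x. ennreal (f x) \<partial>\<mu>) + ennreal B"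
      using marginal[OF plan, of "\<lambda>x. ennreal (f x)"] f add_B[OF plan] f_fst[OF plan] by simp
    also have "\<dots> < \<top>" using f_pos by simp
    finally have P\<pi>: "P \<pi> < \<top>" .
    show ?thesis
    proof (cases "N \<pi> = \<top>")
      case True
      then show ?thesis using P\<pi> unfolding cost[of \<pi>] by (cases "P \<pi>") auto
    next
      case N_fin: False
      have "(\<integral>\<^sup>+x. ennreal (- f x) \<partial>\<mu>) = (\<integral>\<^sup>+p. ennreal (- f (fst p)) \<partial>\<pi>)"
        using marginal[OF plan, of "\<lambda>x. ennreal (- f x)"] f by simp
      also have "\<dots> \<le> (\<integral>\<^sup>+p. e2ennreal (- ?C p) + ennreal B \<partial>\<pi>)"
      proof (rule nn_integral_mono_AE)
        show "AE p in \<pi>. ennreal (- f (fst p)) \<le> e2ennreal (- ?C p) + ennreal B"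
          using eq
        proof eventually_elim
          case (elim p)
          have "ennreal (- f (fst p)) \<le> ennreal (- ?h p + B)"
            using bound[of "snd p"] by (intro ennreal_leI) linarith
          also have "\<dots> \<le> ennreal (- ?h p) + ennreal B"
            using B by (cases "0 \<le> - ?h p") (simp_all add: ennreal_neg ennreal_leI flip: ennreal_plus)
          also have "\<dots> = e2ennreal (- ?C p) + ennreal B" using elim by simp
          finally show ?case .
        qed
      qed
      also have "\<dots> = N \<pi> + ennreal B"
        unfolding N_def using C_measurable[OF plan] by (intro add_B plan) simp
      also have "\<dots> < \<top>" using N_fin by (simp add: less_top[symmetric])
      finally have "(\<integral>\<^sup>+x. ennreal (- f x) \<partial>\<mu>) < \<top>" .
      with f_pos have int_f: "integrable \<mu> f" using f by (auto simp: real_integrable_def)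
      have h_int: "integrable \<sigma> ?h"
        and h_val: "(\<integral>p. ?h p \<partial>\<sigma>) = (\<integral>x. f x \<partial>\<mu>) + (\<integral>y. g y \<partial>\<nu>)"
        if \<sigma>: "\<sigma> \<in> transport_plans \<mu> \<nu>" for \<sigma>
      proof -
        interpret \<sigma>: prob_space \<sigma> by (rule transport_plansD(1)[OF \<sigma>])
        have 1: "integrable \<sigma> (\<lambda>p. f (fst p))"
          using integrable_distr_eq[OF transport_plansD(5)[OF \<sigma>] f] transport_plansD(3)[OF \<sigma>] int_f by simp
        have 2: "integrable \<sigma> (\<lambda>p. g (snd p))"
          by (rule \<sigma>.integrable_const_bound[of _ B]) (use bound g_snd[OF \<sigma>] in auto)
        show "integrable \<sigma> ?h" using 1 2 by simp
        show "(\<integral>p. ?h p \<partial>\<sigma>) = (\<integral>x. f x \<partial>\<mu>) + (\<integral>y. g y \<partial>\<nu>)"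
          using integral_distr[OF transport_plansD(5)[OF \<sigma>] f] integral_distr[OF transport_plansD(6)[OF \<sigma>] g]
            transport_plansD(3,4)[OF \<sigma>] 1 2 by simp
      qed
      let ?r = "\<lambda>p. real_of_ereal (?C p)"
      have "AE p in \<rho>. e2ennreal (?C p) \<noteq> \<infinity>"
        by (rule nn_integral_PInf_AE) (use C_measurable[OF \<rho>] P_fin in \<open>auto simp: P_def\<close>)
      with le[OF \<rho>] have C_real: "AE p in \<rho>. ?C p = ereal (?r p) \<and> ?h p \<le> ?r p"
      proof eventually_elim
        case (elim p)
        then show ?case by (cases "?C p") auto
      qed
      have "(\<integral>\<^sup>+p. ennreal (?r p) \<partial>\<rho>) = P \<rho>"
        unfolding P_def
        by (rule nn_integral_cong_AE, rule eventually_mono[OF C_real]) (metis e2ennreal_ereal)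
      moreover have "(\<integral>\<^sup>+p. ennreal (- ?r p) \<partial>\<rho>) \<le> (\<integral>\<^sup>+p. ennreal (- ?h p) \<partial>\<rho>)"
        by (rule nn_integral_mono_AE, rule eventually_mono[OF C_real]) (auto intro!: ennreal_leI)
      moreover have "(\<integral>\<^sup>+p. ennreal (- ?h p) \<partial>\<rho>) < \<top>"
        using h_int[OF \<rho>] by (simp add: real_integrable_def less_top)
      ultimately have r_int: "integrable \<rho> ?r"
        using P_fin C_measurable[OF \<rho>] unfolding real_integrable_def by (auto simp: top_unique)
      have "transport_cost c \<pi> = ereal (\<integral>p. ?h p \<partial>\<pi>)"
        by (rule transport_cost_eq_integral[OF h_int[OF plan] eq])
      also have "(\<integral>p. ?h p \<partial>\<pi>) = (\<integral>p. ?h p \<partial>\<rho>)" using h_val[OF plan] h_val[OF \<rho>] by simp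
      also have "ereal (\<integral>p. ?h p \<partial>\<rho>) \<le> ereal (\<integral>p. ?r p \<partial>\<rho>)"
        using integral_mono_AE[OF h_int[OF \<rho>] r_int] C_real by simp
      also have "\<dots> = transport_cost c \<rho>"
        by (rule transport_cost_eq_integral[OF r_int, symmetric])
           (rule eventually_mono[OF C_real], simp)
      finally show ?thesis .
    qed
  qed
  then show ?thesis
    unfolding optimal_plan_def using plan by (auto intro!: antisym INF_greatest INF_lower)
qed

section \<open>Transport plans from cells\<close>

text \<open>
  A measurable choice of one cell per point: the least index works, and almost everywhere there is
  nothing to choose.
\<close>

lemma (in prob_space) exists_index_map:
  fixes I :: "nat set"
  assumes "finite I" "I \<noteq> {}" and C: "\<And>i. i \<in> I \<Longrightarrow> C i \<in> sets M"
    and ex: "AE x in M. \<exists>i\<in>I. x \<in> C i"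
    and unique: "AE x in M. \<forall>i\<in>I. \<forall>j\<in>I. x \<in> C i \<longrightarrow> x \<in> C j \<longrightarrow> i = j"
  obtains s where "s \<in> measurable M (count_space I)" "AE x in M. x \<in> C (s x)"
    "\<And>i. i \<in> I \<Longrightarrow> prob (s -` {i} \<inter> space M) = prob (C i)"
proof -
  obtain i0 where i0: "i0 \<in> I" using \<open>I \<noteq> {}\<close> by auto
  define l where "l x = (LEAST i. i \<in> I \<and> x \<in> C i)" for x
  define s where "s x = (if l x \<in> I then l x else i0)" for x
  have pred: "Measurable.pred M (\<lambda>x. i \<in> I \<and> x \<in> C i)" for i
    using C[of i] by (cases "i \<in> I") (auto simp: pred_def Int_def[symmetric] Int_commute sets.Int_space_eq1)
  have "l \<in> measurable M (count_space UNIV)"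
    unfolding l_def[abs_def] by (intro measurable_Least pred)
  moreover have "(\<lambda>n. if n \<in> I then n else i0) \<in> measurable (count_space UNIV) (count_space I)"
    using i0 by auto
  ultimately have s: "s \<in> measurable M (count_space I)"
    unfolding s_def[abs_def] by (rule measurable_compose)
  have in_C: "AE x in M. x \<in> C (s x)"
    using ex
  proof eventually_elim
    case (elim x)
    then have "l x \<in> I \<and> x \<in> C (l x)" unfolding l_def by (metis (mono_tags, lifting) LeastI_ex)
    then show ?case by (simp add: s_def)
  qed
  have s_I: "s x \<in> I" for x using i0 by (simp add: s_def)
  have "prob (s -` {i} \<inter> space M) = prob (C i)" if i: "i \<in> I" for i
  proof (rule finite_measure_eq_AE)
    show "AE x in M. (x \<in> s -` {i} \<inter> space M) = (x \<in> C i)"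
      using in_C unique AE_space
    proof eventually_elim
      case (elim x)
      then show ?case using i s_I[of x] by auto
    qed
    show "s -` {i} \<inter> space M \<in> sets M" using i by (intro measurable_sets[OF s]) auto
  qed (rule C[OF i])
  with that s in_C show thesis by blast
qed

lemma graph_plan:
  assumes \<mu>: "prob_space \<mu>" and T: "T \<in> measurable \<mu> \<nu>" and T_distr: "distr \<mu> \<nu> T = \<nu>"
  shows "distr \<mu> (\<mu> \<Otimes>\<^sub>M \<nu>) (\<lambda>x. (x, T x)) \<in> transport_plans \<mu> \<nu>"
proof -
  have g: "(\<lambda>x. (x, T x)) \<in> measurable \<mu> (\<mu> \<Otimes>\<^sub>M \<nu>)" using T by measurable
  have "distr (distr \<mu> (\<mu> \<Otimes>\<^sub>M \<nu>) (\<lambda>x. (x, T x))) \<mu> fst = \<mu>"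
    using g by (simp add: distr_distr comp_def distr_id)
  moreover have "distr (distr \<mu> (\<mu> \<Otimes>\<^sub>M \<nu>) (\<lambda>x. (x, T x))) \<nu> snd = \<nu>"
    using g T_distr by (simp add: distr_distr comp_def)
  ultimately show ?thesis
    using prob_space.prob_space_distr[OF \<mu> g] by (simp add: transport_plans_def)
qed

context semidiscrete begin

text \<open>
  A weight \<open>-\<infinity>\<close> removes a point of \<open>Y\<close> from the infimum, because the cost is never \<open>-\<infinity>\<close>.
\<close>

lemma c_transform_eq_INF:
  assumes u: "inj_on u I" "u ` I \<subseteq> Y" and ac: "\<And>i x. i \<in> I \<Longrightarrow> a i x = c x (u i)"
    and c: "\<And>x y. y \<in> Y \<Longrightarrow> c x y > -\<infinity>"
    and \<psi>Y: "\<And>i. i \<in> I \<Longrightarrow> \<psi>Y (u i) = ereal (\<psi> i)" "\<And>y. y \<notin> u ` I \<Longrightarrow> \<psi>Y y = -\<infinity>"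
  shows "c_transform_Y Y c \<psi>Y x = (INF i\<in>I. a i x - ereal (\<psi> i))"
proof -
  have "c_transform_Y Y c \<psi>Y x = (INF y\<in>u ` I. c x y - \<psi>Y y)"
    unfolding c_transform_Y_def
  proof (rule antisym)
    show "(INF y\<in>u ` I. c x y - \<psi>Y y) \<le> (INF y\<in>Y. c x y - \<psi>Y y)"
    proof (rule INF_greatest)
      fix y assume y: "y \<in> Y"
      show "(INF y\<in>u ` I. c x y - \<psi>Y y) \<le> c x y - \<psi>Y y"
      proof (cases "y \<in> u ` I")
        case False
        then show ?thesis using c[OF y, of x] \<psi>Y(2)[OF False] by (cases "c x y") auto
      qed (rule INF_lower)
    qed
  qed (rule INF_superset_mono[OF u(2) order_refl])
  also have "\<dots> = (INF i\<in>I. a i x - ereal (\<psi> i))"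
    unfolding image_image by (rule INF_cong) (simp_all add: ac \<psi>Y)
  finally show ?thesis .
qed

text \<open>
  The second \<open>c\<close>-transform at \<open>u i\<close> is at least \<open>\<psi> i\<close> in general, and a single point of the cell
  shows that it equals \<open>\<psi> i\<close>. Points that reach nothing contribute \<open>\<infinity> - \<infinity> = \<infinity>\<close> to the infimum.
\<close>

lemma cell_subset_c_subgradient:
  assumes u: "inj_on u I" "u ` I \<subseteq> Y" and ac: "\<And>i x. i \<in> I \<Longrightarrow> a i x = c x (u i)"
    and \<phi>: "\<And>x. \<phi> x = (INF i\<in>I. a i x - ereal (\<psi> i))"
    and i: "i \<in> I" and x: "x \<in> cell \<psi> i"
  shows "(x, u i) \<in> c_subgradient Y c \<phi>"
proof -
  have covered: "\<phi> z = ereal (pot \<psi> z)" if "\<exists>i\<in>I. a i z < \<infinity>" for z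
    using INF_eq_pot[OF that] \<phi> by simp
  have x_eq: "c x (u i) = ereal (pot \<psi> x + \<psi> i)" using x i ac by (simp add: cell_def)
  have \<phi>x: "\<phi> x = ereal (pot \<psi> x)" by (rule covered[OF cell_covered[OF x i]])
  have "c_transform_X c \<phi> (u i) = ereal (\<psi> i)"
    unfolding c_transform_X_def
  proof (rule antisym)
    show "(INF z. c z (u i) - \<phi> z) \<le> ereal (\<psi> i)"
      by (rule INF_lower2[of x]) (simp_all add: x_eq \<phi>x)
    show "ereal (\<psi> i) \<le> (INF z. c z (u i) - \<phi> z)"
    proof (rule INF_greatest)
      fix z
      show "ereal (\<psi> i) \<le> c z (u i) - \<phi> z"
      proof (cases "\<exists>i\<in>I. a i z < \<infinity>")
        case True
        then show ?thesis
          using pot_le[OF True i, of \<psi>] covered[OF True] ac[OF i, of z] by (cases "c z (u i)") auto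
      next
        case False
        then show ?thesis using i ac[OF i, of z] by auto
      qed
    qed
  qed
  then show ?thesis using u i x_eq \<phi>x by (auto simp: c_subgradient_def)
qed

end

section \<open>Existence of an optimal plan in a subgradient\<close>

theorem theorem1p3:
  fixes u :: "nat \<Rightarrow> 'b" and m :: nat and Y :: "'b set"
    and c :: "'a::polish_space \<Rightarrow> 'b \<Rightarrow> ereal"
    and \<mu> :: "'a measure" and \<nu> :: "'b measure" and \<alpha> :: "nat \<Rightarrow> real"
  assumes distinct_u: "inj_on u {1..m}"
    and Y: "Y = u ` {1..m}"
    and c_measurable: "(\<lambda>(x, y). c x y) \<in> borel_measurable (borel \<Otimes>\<^sub>M count_space Y)"
    and c_values: "\<And>x y. y \<in> Y \<Longrightarrow> c x y > -\<infinity>"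
    and \<mu>: "prob_space \<mu>" "sets \<mu> = sets borel"
    and \<mu>_regular: "c_regular Y c \<mu>"
    and \<nu>: "prob_space \<nu>" "sets \<nu> = sets (count_space Y)"
    and \<nu>_eq: "\<And>B. B \<subseteq> Y \<Longrightarrow>
      measure \<nu> B = (\<Sum>i=1..m. \<alpha> i * measure (return (count_space Y) (u i)) B)"
    and overlap: "\<And>i j. i \<in> {1..m} \<Longrightarrow> j \<in> {1..m} \<Longrightarrow> i \<noteq> j \<Longrightarrow>
      \<exists>U. open U \<and> U \<noteq> {} \<and> U \<subseteq> {x. c x (u i) < \<infinity>} \<inter> {x. c x (u j) < \<infinity>}"
    and compatible: "strongly_c_compatible c \<mu> \<nu>"
  shows "\<exists>\<pi>. optimal_plan c \<mu> \<nu> \<pi> \<and>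
           (\<exists>\<phi>\<in>c_class Y c. AE p in \<pi>. p \<in> c_subgradient Y c \<phi>)"
proof -
  interpret \<mu>: prob_space \<mu> by (rule \<mu>(1))
  interpret \<nu>: prob_space \<nu> by (rule \<nu>(1))
  have space_\<mu>: "space \<mu> = UNIV" using sets_eq_imp_space_eq[OF \<mu>(2)] by simp
  have space_\<nu>: "space \<nu> = Y" using sets_eq_imp_space_eq[OF \<nu>(2)] by simp
  have sets_\<nu>: "sets \<nu> = Pow Y" using \<nu>(2) by simp
  have fin_Y: "finite Y" using Y by simp
  have \<nu>_image: "measure \<nu> (u ` J) = (\<Sum>i\<in>J. \<alpha> i)" if J: "J \<subseteq> {1..m}" for J
  proof -
    have "measure \<nu> (u ` J) = (\<Sum>i=1..m. \<alpha> i * measure (return (count_space Y) (u i)) (u ` J))"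
      using J Y by (intro \<nu>_eq) auto
    also have "\<dots> = (\<Sum>i=1..m. if i \<in> J then \<alpha> i else 0)"
    proof (rule sum.cong)
      fix i assume i: "i \<in> {1..m}"
      then have "u i \<in> u ` J \<longleftrightarrow> i \<in> J" by (rule inj_on_image_mem_iff[OF distinct_u _ J])
      moreover have "u ` J \<subseteq> Y" using J Y by auto
      ultimately show "\<alpha> i * measure (return (count_space Y) (u i)) (u ` J) = (if i \<in> J then \<alpha> i else 0)"
        by (simp add: measure_return indicator_def)
    qed simp
    also have "\<dots> = (\<Sum>i\<in>J. \<alpha> i)"
      using J by (simp add: sum.inter_restrict[symmetric] Int_absorb1)
    finally show ?thesis .
  qed
  have \<alpha>_nonneg: "0 \<le> \<alpha> i" if "i \<in> {1..m}" for i
    using \<nu>_image[of "{i}"] that measure_nonneg[of \<nu> "u ` {i}"] by simp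
  \<comment> \<open>Points of mass zero are discarded; this makes the masses of proper subsets of \<open>I\<close> less than one.\<close>
  define I where "I = {i \<in> {1..m}. 0 < \<alpha> i}"
  define a where "a i x = c x (u i)" for i x
  have I: "I \<subseteq> {1..m}" "finite I" by (auto simp: I_def)
  have uI: "u ` I \<subseteq> Y" "inj_on u I" using I Y inj_on_subset[OF distinct_u] by auto
  have "(\<Sum>i\<in>I. \<alpha> i) = (\<Sum>i=1..m. \<alpha> i)"
    using \<alpha>_nonneg by (intro sum.mono_neutral_left) (force simp: I_def)+
  also have "\<dots> = 1" using \<nu>_image[of "{1..m}"] \<nu>.prob_space space_\<nu> Y by simp
  finally have sum_\<alpha>: "(\<Sum>i\<in>I. \<alpha> i) = 1" .
  have a_measurable: "a i \<in> borel_measurable \<mu>" if "i \<in> I" for i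
  proof -
    have "u i \<in> Y" using uI that by auto
    then have "(\<lambda>x. (x, u i)) \<in> measurable borel (borel \<Otimes>\<^sub>M count_space Y)" by simp
    from measurable_compose[OF this c_measurable] show ?thesis
      by (simp add: a_def[abs_def] measurable_cong_sets[OF \<mu>(2) refl])
  qed
  \<comment> \<open>Compatibility for the complement \<open>?A\<close> of the set \<open>S\<close> that reaches \<open>J\<close>: every point of
    \<open>u ` J\<close> is unreachable from \<open>?A\<close>.\<close>
  have Hall: "measure \<mu> {x \<in> space \<mu>. \<exists>i\<in>J. a i x < \<infinity>} \<ge> (\<Sum>i\<in>J. \<alpha> i)"
    "J \<noteq> I \<Longrightarrow> J \<noteq> {} \<Longrightarrow> (\<Sum>i\<in>J. \<alpha> i) < measure \<mu> {x \<in> space \<mu>. \<exists>i\<in>J. a i x < \<infinity>}"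
    if J: "J \<subseteq> I" for J
  proof -
    define S where "S = {x \<in> space \<mu>. \<exists>i\<in>J. a i x < \<infinity>}"
    have S: "S \<in> sets \<mu>"
    proof -
      have "{x \<in> space \<mu>. a i x < \<infinity>} \<in> sets \<mu>" if "i \<in> I" for i
        using a_measurable[OF that] by measurable
      then show ?thesis unfolding S_def
        using J finite_subset[OF J I(2)] by (intro sets.sets_Collect_finite_Ex) auto
    qed
    let ?A = "space \<mu> - S" and ?D = "{y \<in> space \<nu>. \<forall>x\<in>space \<mu> - S. c x y = \<infinity>}"
    have A: "?A \<in> sets \<mu>" "measure \<mu> ?A = 1 - measure \<mu> S"
      using S \<mu>.prob_compl by auto
    have "u ` J \<subseteq> ?D" using J uI by (auto simp: space_\<nu> S_def a_def)
    then have D: "(\<Sum>i\<in>J. \<alpha> i) \<le> measure \<nu> ?D"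
      using \<nu>_image[of J] J I(1) \<nu>.finite_measure_mono[of "u ` J" ?D] by (auto simp: sets_\<nu> space_\<nu>)
    have "measure \<mu> ?A + measure \<nu> ?D \<le> 1"
      using compatible A(1) by (simp add: strongly_c_compatible_def c_compatible_def)
    then show le: "(\<Sum>i\<in>J. \<alpha> i) \<le> measure \<mu> {x \<in> space \<mu>. \<exists>i\<in>J. a i x < \<infinity>}"
      using D A(2) unfolding S_def[symmetric] by linarith
    assume neq: "J \<noteq> I" and ne: "J \<noteq> {}"
    have pos: "0 < (\<Sum>i\<in>J. \<alpha> i)" using J ne I(2) finite_subset[OF J] by (intro sum_pos) (auto simp: I_def)
    obtain k where k: "k \<in> I - J" using J neq by blast
    have less: "(\<Sum>i\<in>J. \<alpha> i) < 1"
      unfolding sum_\<alpha>[symmetric]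
      by (rule sum_strict_mono2[OF I(2) J k]) (use k in \<open>auto simp: I_def\<close>)
    \<comment> \<open>Strictness holds by strong compatibility when \<open>0 < measure \<mu> ?A < 1\<close>. The value 1 is impossible
      since \<open>J\<close> has positive mass, and for the value 0 it holds since \<open>J\<close> has mass less than one.\<close>
    show "(\<Sum>i\<in>J. \<alpha> i) < measure \<mu> {x \<in> space \<mu>. \<exists>i\<in>J. a i x < \<infinity>}"
    proof (cases "measure \<mu> S = 1")
      case False
      then have "0 < measure \<mu> ?A" "measure \<mu> ?A < 1"
        using A(2) \<mu>.prob_le_1[of S] le pos unfolding S_def[symmetric] by linarith+
      then have "measure \<mu> ?A + measure \<nu> ?D < 1"
        using compatible A(1) unfolding strongly_c_compatible_def by blast
      then show ?thesis using D A(2) unfolding S_def[symmetric] by linarith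
    qed (use less in \<open>simp add: S_def\<close>)
  qed
  interpret S: semidiscrete \<mu> I a \<alpha>
  proof
    show "I \<noteq> {}" using sum_\<alpha> by auto
    have "measure \<mu> {x \<in> space \<mu>. \<exists>i\<in>I. a i x < \<infinity>} = 1"
      using Hall(1)[OF order_refl] sum_\<alpha> \<mu>.prob_le_1[of "{x \<in> space \<mu>. \<exists>i\<in>I. a i x < \<infinity>}"] by linarith
    from \<mu>.AE_prob_1[OF this] show "AE x in \<mu>. \<exists>i\<in>I. a i x < \<infinity>"
      by eventually_elim blast
    show "AE x in \<mu>. \<not> (\<bar>a i x\<bar> \<noteq> \<infinity> \<and> \<bar>a j x\<bar> \<noteq> \<infinity> \<and> a i x - a j x = ereal t)"
      if "i \<in> I" "j \<in> I" "i \<noteq> j" for i j t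
    proof (rule AE_I')
      have "u i \<noteq> u j" using that uI(2) by (auto dest: inj_onD)
      then show "{z \<in> space \<mu>. \<bar>c z (u i)\<bar> \<noteq> \<infinity> \<and> \<bar>c z (u j)\<bar> \<noteq> \<infinity> \<and> c z (u i) - c z (u j) = ereal t} \<in> null_sets \<mu>"
        using \<mu>_regular that uI(1) unfolding c_regular_def by blast
    qed (auto simp: a_def)
  qed (use I a_measurable c_values uI sum_\<alpha> Hall(2) in \<open>auto simp: a_def I_def\<close>)
  obtain \<psi> where \<psi>: "\<And>i. i \<in> I \<Longrightarrow> measure \<mu> (S.cell \<psi> i) = \<alpha> i"
    using S.exists_cells_with_masses by blast
  obtain s where s: "s \<in> measurable \<mu> (count_space I)" "AE x in \<mu>. x \<in> S.cell \<psi> (s x)"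
    "\<And>i. i \<in> I \<Longrightarrow> measure \<mu> (s -` {i} \<inter> space \<mu>) = measure \<mu> (S.cell \<psi> i)"
    using \<mu>.exists_index_map[OF S.finite_I S.nonempty_I S.cell_measurable S.AE_exists_cell S.AE_cell_unique] by metis
  have s_I: "s x \<in> I" for x using measurable_space[OF s(1), of x] by (simp add: space_\<mu>)
  define T where "T x = u (s x)" for x
  have "u \<in> measurable (count_space I) \<nu>" using uI(1) by (auto simp: space_\<nu>)
  then have T: "T \<in> measurable \<mu> \<nu>"
    unfolding T_def[abs_def] by (rule measurable_compose[OF s(1)])
  have T_distr: "distr \<mu> \<nu> T = \<nu>"
  proof (rule measure_eqI_finite[where A = Y])
    fix y assume "y \<in> Y"
    then obtain i where i: "i \<in> {1..m}" "y = u i" using Y by auto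
    have "s x \<in> {1..m}" for x using s_I I(1) by blast
    then have "T x = y \<longleftrightarrow> s x = i" for x
      using inj_on_eq_iff[OF distinct_u] i by (simp add: T_def)
    then have "T -` {y} \<inter> space \<mu> = s -` {i} \<inter> space \<mu>" by auto
    moreover have "measure \<mu> (s -` {i} \<inter> space \<mu>) = \<alpha> i"
    proof (cases "i \<in> I")
      case False
      then have "s -` {i} \<inter> space \<mu> = {}" using s_I by auto
      then show ?thesis using False i \<alpha>_nonneg[of i] by (simp add: I_def)
    qed (simp add: s(3) \<psi>)
    ultimately have "measure (distr \<mu> \<nu> T) {y} = measure \<nu> {y}"
      using \<nu>_image[of "{i}"] i T Y by (simp add: measure_distr sets_\<nu>)
    then show "emeasure (distr \<mu> \<nu> T) {y} = emeasure \<nu> {y}"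
      using \<nu>.emeasure_eq_measure
        prob_space.finite_measure[OF \<mu>.prob_space_distr[OF T]]
      by (simp add: finite_measure.emeasure_eq_measure)
  qed (use sets_\<nu> fin_Y in auto)
  define \<pi> where "\<pi> = distr \<mu> (\<mu> \<Otimes>\<^sub>M \<nu>) (\<lambda>x. (x, T x))"
  have plan: "\<pi> \<in> transport_plans \<mu> \<nu>" unfolding \<pi>_def by (rule graph_plan[OF \<mu>(1) T T_distr])
  \<comment> \<open>A measurable subset of the \<open>c\<close>-subgradient that carries the plan.\<close>
  define G where "G = (\<Union>i\<in>I. S.cell \<psi> i \<times> {u i})"
  have G: "G \<in> sets (\<mu> \<Otimes>\<^sub>M \<nu>)"
    unfolding G_def using I(2) uI(1) sets_\<nu> by (intro sets.finite_UN pair_measureI) auto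
  have AE_G: "AE p in \<pi>. p \<in> G"
  proof -
    have "(\<lambda>x. (x, T x)) \<in> measurable \<mu> (\<mu> \<Otimes>\<^sub>M \<nu>)" using T by measurable
    moreover have "{p \<in> space (\<mu> \<Otimes>\<^sub>M \<nu>). p \<in> G} \<in> sets (\<mu> \<Otimes>\<^sub>M \<nu>)"
      using G sets.sets_into_space[OF G] by (simp add: Collect_conj_eq Int_absorb1)
    ultimately show ?thesis
      unfolding \<pi>_def using s(2) s_I
      by (subst AE_distr_iff) (auto simp: G_def T_def elim!: eventually_mono)
  qed
  define g where "g y = (if y \<in> u ` I then \<psi> (inv_into I u y) else 0)" for y
  have g_u: "g (u i) = \<psi> i" if "i \<in> I" for i using that uI(2) by (simp add: g_def)
  have "optimal_plan c \<mu> \<nu> \<pi>"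
  proof (rule optimal_plan_of_potentials[OF plan, where f = "S.pot \<psi>" and g = g])
    show "g \<in> borel_measurable \<nu>" by (simp add: measurable_cong_sets[OF \<nu>(2) refl])
    show "\<bar>g y\<bar> \<le> (\<Sum>i\<in>I. \<bar>\<psi> i\<bar>)" for y
    proof (cases "y \<in> u ` I")
      case True
      then show ?thesis
        using g_u member_le_sum[of _ I "\<lambda>i. \<bar>\<psi> i\<bar>"] I(2) by auto
    qed (simp add: g_def sum_nonneg)
    have "sets (\<mu> \<Otimes>\<^sub>M \<nu>) = sets (borel \<Otimes>\<^sub>M count_space Y)"
      by (rule sets_pair_measure_cong[OF \<mu>(2) \<nu>(2)])
    then show "(\<lambda>p. c (fst p) (snd p)) \<in> borel_measurable (\<mu> \<Otimes>\<^sub>M \<nu>)"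
      using c_measurable measurable_cong_sets[OF _ refl] unfolding case_prod_beta' by blast
    show "AE p in \<pi>. c (fst p) (snd p) = ereal (S.pot \<psi> (fst p) + g (snd p))"
      using AE_G
    proof eventually_elim
      case (elim p)
      then show ?case by (auto simp: G_def S.cell_def a_def g_u)
    qed
    fix \<rho> assume \<rho>: "\<rho> \<in> transport_plans \<mu> \<nu>"
    \<comment> \<open>The bound \<open>pot \<psi> x + \<psi> i \<le> a i x\<close> is available only on \<open>I\<close>, which carries the second marginal of every plan.\<close>
    have "AE y in \<nu>. y \<in> u ` I" using \<nu>_image[OF I(1)] sum_\<alpha> by (intro \<nu>.AE_prob_1) simp
    then have "AE y in distr \<rho> \<nu> snd. y \<in> u ` I"
      by (simp only: transport_plansD(4)[OF \<rho>])
    then have "AE p in \<rho>. snd p \<in> u ` I"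
      by (rule AE_distrD[OF transport_plansD(6)[OF \<rho>]])
    then show "AE p in \<rho>. ereal (S.pot \<psi> (fst p) + g (snd p)) \<le> c (fst p) (snd p)"
    proof eventually_elim
      case (elim p)
      then obtain i where i: "i \<in> I" "snd p = u i" by auto
      show ?case
      proof (cases "\<exists>i\<in>I. a i (fst p) < \<infinity>")
        case True
        then show ?thesis using S.pot_le[OF True i(1), of \<psi>] i by (simp add: a_def g_u)
      qed (use i in \<open>auto simp: a_def\<close>)
    qed
  qed simp
  moreover define \<psi>Y where "\<psi>Y y = (if y \<in> u ` I then ereal (g y) else -\<infinity>)" for y
  let ?\<phi> = "c_transform_Y Y c \<psi>Y"
  have \<phi>: "?\<phi> x = (INF i\<in>I. a i x - ereal (\<psi> i))" for x
    by (rule S.c_transform_eq_INF[of u]) (use uI c_values g_u in \<open>auto simp: a_def \<psi>Y_def\<close>)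
  have "G \<subseteq> c_subgradient Y c ?\<phi>"
    using S.cell_subset_c_subgradient[of u Y c ?\<phi> \<psi>] uI \<phi> by (auto simp: G_def a_def)
  then have "AE p in \<pi>. p \<in> c_subgradient Y c ?\<phi>" using AE_G by (auto elim!: eventually_mono)
  moreover have "?\<phi> \<in> c_class Y c" by (auto simp: c_class_def)
  ultimately show ?thesis by blast
qed

end
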